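(* Let $T:\{0,1\}^*\to\{0,1\}^*$ be an aperiodic morphism. Then $T$ is either order-preserving on infinite words or order-reversing on infinite words.
   Context: A binary morphism $T$ is aperiodic if $T(0)$ and $T(1)$ are not powers of a common word. Infinite binary words are ordered lexicographically with $0<1$ ($u<v$ if $u=xay$, $v=xbz$ with letters $a<b$). $T$ is order-preserving on infinite words if for all infinite words $u\le v$ we have $T(u)\le T(v)$; it is order-reversing on infinite words if for all infinite words $u<v$ we have $T(u)>T(v)$. *)

theory Defs
  imports "HOL-Library.Stream"
begin

text \<open>The letters 0 and 1 are \<^term>\<open>False\<close> and \<^term>\<open>True\<close>, so that the order on the letters is the
  library order on \<^typ>\<open>bool\<close>.\<close>

type_synonym word = "bool list"
type_synonym inf_word = "bool stream"

definition morphism :: "(word \<Rightarrow> word) \<Rightarrow> bool" where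
  "morphism T \<longleftrightarrow> (\<forall>u v. T (u @ v) = T u @ T v)"

definition word_power :: "word \<Rightarrow> nat \<Rightarrow> word" where
  "word_power w n = concat (replicate n w)"

text \<open>The exponent 0 is allowed, so the empty word is a power of every word; hence an aperiodic
  morphism maps both letters to nonempty words.\<close>

definition aperiodic :: "(word \<Rightarrow> word) \<Rightarrow> bool" where
  "aperiodic T \<longleftrightarrow> \<not> (\<exists>w m n. T [False] = word_power w m \<and> T [True] = word_power w n)"

text \<open>The infinite word \<open>T(u\<^sub>0) T(u\<^sub>1) T(u\<^sub>2) \<dots>\<close>. The value is meaningful only if both
  letters have nonempty images, since \<^const>\<open>flat\<close> is only meaningful for streams of nonempty lists.\<close>

definition inf_image :: "(word \<Rightarrow> word) \<Rightarrow> inf_word \<Rightarrow> inf_word" where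
  "inf_image T u = flat (smap (\<lambda>a. T [a]) u)"

definition lex_less :: "inf_word \<Rightarrow> inf_word \<Rightarrow> bool" where
  "lex_less u v \<longleftrightarrow> (\<exists>x a b y z. u = x @- a ## y \<and> v = x @- b ## z \<and> a < b)"

definition lex_le :: "inf_word \<Rightarrow> inf_word \<Rightarrow> bool" where
  "lex_le u v \<longleftrightarrow> lex_less u v \<or> u = v"

definition order_preserving_inf :: "(word \<Rightarrow> word) \<Rightarrow> bool" where
  "order_preserving_inf T \<longleftrightarrow> (\<forall>u v. lex_le u v \<longrightarrow> lex_le (inf_image T u) (inf_image T v))"

definition order_reversing_inf :: "(word \<Rightarrow> word) \<Rightarrow> bool" where
  "order_reversing_inf T \<longleftrightarrow> (\<forall>u v. lex_less u v \<longrightarrow> lex_less (inf_image T v) (inf_image T u))"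

lemma aperiodic_nonempty:
  assumes "aperiodic T"
  shows "T [a] \<noteq> []"
proof
  assume e: "T [a] = []"
  have "T [False] = word_power (T [\<not> a]) (if a then 1 else 0)"
    "T [True] = word_power (T [\<not> a]) (if a then 0 else 1)"
    using e by (cases a; simp add: word_power_def)+
  with assms show False
    unfolding aperiodic_def by blast
qed

lemma inf_image_shift:
  assumes "morphism T" "aperiodic T"
  shows "inf_image T (x @- u) = T x @- inf_image T u"
proof (induction x)
  case Nil
  have "T ([] @ []) = T [] @ T []"
    using assms(1) unfolding morphism_def by blast
  then show ?case by simp
next
  case (Cons a x)
  have "T (a # x) = T [a] @ T x"
    using assms(1) unfolding morphism_def by (metis append_Cons append_Nil)
  with Cons aperiodic_nonempty[OF assms(2)] show ?case
    by (simp add: inf_image_def)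
qed

end

theory Submission
  imports Defs "HOL-Library.Sublist"
begin

text \<open>Put \<open>A = T(0)\<close> and \<open>B = T(1)\<close>; aperiodicity means \<open>AB \<noteq> BA\<close>. Then there are a word \<open>z\<close> and
  letters \<open>a \<noteq> b\<close> such that every infinite product of \<open>A\<close>'s and \<open>B\<close>'s starts with \<open>za\<close> if its first
  factor is \<open>A\<close>, and with \<open>zb\<close> if its first factor is \<open>B\<close>. So the comparison of \<open>T(u)\<close> with \<open>T(v)\<close>
  is decided by the first letter where \<open>u\<close> and \<open>v\<close> differ, always in the same direction.
  The word \<open>z\<close> is found by Euclidean descent: it is immediate if \<open>A\<close> and \<open>B\<close> are incomparable for the
  prefix order, and if \<open>B = AC\<close>, then \<open>z\<close> is \<open>A\<close> followed by the corresponding word for the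
  pair \<open>(A, C)\<close>.\<close>

coinductive omega_product :: "word \<Rightarrow> word \<Rightarrow> inf_word \<Rightarrow> bool" for A B where
  left: "omega_product A B s \<Longrightarrow> omega_product A B (A @- s)"
| right: "omega_product A B s \<Longrightarrow> omega_product A B (B @- s)"

lemma omega_product_swap:
  assumes "omega_product A B s"
  shows "omega_product B A s"
  using assms
proof (coinduction arbitrary: s)
  case omega_product
  then show ?case by (cases rule: omega_product.cases) auto
qed

lemma omega_product_append:
  assumes "omega_product A (A @ C) s"
  shows "omega_product A C s"
proof -
  \<comment> \<open>The second disjunct is the state in which the \<open>A\<close> of a factor
    \<open>A @ C\<close> has been read and its \<open>C\<close> is still to come.\<close>
  have "omega_product A (A @ C) s \<or> (\<exists>s'. s = C @- s' \<and> omega_product A (A @ C) s')"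
    using assms by blast
  then show ?thesis
  proof (coinduction arbitrary: s)
    case omega_product
    then show ?case
    proof
      assume "omega_product A (A @ C) s"
      then show ?thesis
        by (cases rule: omega_product.cases) auto
    qed auto
  qed
qed

lemma omega_product_append_imp_prefix:
  assumes "omega_product A (A @ C) s"
  shows "\<exists>s'. s = A @- s' \<and> omega_product A C s'"
  using assms
proof (cases rule: omega_product.cases)
  case (left s')
  then show ?thesis using omega_product_append by blast
next
  case (right s')
  then have "s = A @- (C @- s')" "omega_product A C (C @- s')"
    using omega_product_append omega_product.right by auto
  then show ?thesis by blast
qed

text \<open>\<open>s\<close> is the rest of the product after its first factor. Each conjunct holds
  for every \<open>s\<close>, so the two products compared may continue differently.\<close>

definition separated_by :: "word \<Rightarrow> bool \<Rightarrow> bool \<Rightarrow> word \<Rightarrow> word \<Rightarrow> bool" where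
  "separated_by z a b A B \<longleftrightarrow> a \<noteq> b \<and>
    (\<forall>s. omega_product A B s \<longrightarrow> (\<exists>t. A @- s = z @- a ## t) \<and> (\<exists>t. B @- s = z @- b ## t))"

lemma separated_by_swap: "separated_by z a b A B \<Longrightarrow> separated_by z b a B A"
  unfolding separated_by_def using omega_product_swap[of B A] by blast

text \<open>Since \<open>s\<close> itself starts with \<open>A\<close>, cancelling one
  \<open>A\<close> leaves two products of \<open>A\<close> and \<open>C\<close>, one with first
  factor \<open>A\<close>, the other with first factor \<open>C\<close>.\<close>

lemma separated_by_append:
  assumes "separated_by z a b A C"
  shows "separated_by (A @ z) a b A (A @ C)"
  unfolding separated_by_def
proof (intro conjI allI impI)
  show "a \<noteq> b"
    using assms by (simp add: separated_by_def)
next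
  fix s
  assume s: "omega_product A (A @ C) s"
  then obtain s' where s': "s = A @- s'" "omega_product A C s'"
    using omega_product_append_imp_prefix by blast
  then show "\<exists>t. A @- s = (A @ z) @- a ## t"
    using assms by (auto simp: separated_by_def)
  show "\<exists>t. (A @ C) @- s = (A @ z) @- b ## t"
    using assms omega_product_append[OF s] by (auto simp: separated_by_def)
qed

lemma separated_by_if_not_commute:
  assumes "A @ B \<noteq> B @ A"
  shows "\<exists>z a b. separated_by z a b A B"
  using assms
proof (induction "length A + length B" arbitrary: A B rule: less_induct)
  case less
  consider "A \<parallel> B" | "prefix A B" | "prefix B A" by blast
  then show ?case
  proof cases
    case 1
    obtain z a b A' B' where "a \<noteq> b" "A = z @ a # A'" "B = z @ b # B'"
      using parallel_decomp[OF 1] by blast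
    then have "separated_by z a b A B"
      by (simp add: separated_by_def)
    then show ?thesis by blast
  next
    case 2
    then obtain C where C: "B = A @ C" by (auto simp: prefix_def)
    \<comment> \<open>If \<open>A\<close> were empty or commuted with \<open>C\<close>, it would
      commute with \<open>A @ C\<close>; so the pair \<open>A\<close>, \<open>C\<close> is shorter
      and still does not commute.\<close>
    have "\<exists>z a b. separated_by z a b A C"
      using less.prems C by (intro less.hyps) auto
    then show ?thesis
      unfolding C using separated_by_append by blast
  next
    case 3
    then obtain C where C: "A = B @ C" by (auto simp: prefix_def)
    have "\<exists>z a b. separated_by z a b B C"
      using less.prems C by (intro less.hyps) auto
    then show ?thesis
      unfolding C using separated_by_append separated_by_swap by blast
  qed
qed

lemma aperiodic_imp_not_commute:
  assumes "aperiodic T"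
  shows "T [False] @ T [True] \<noteq> T [True] @ T [False]"
proof
  assume "T [False] @ T [True] = T [True] @ T [False]"
  then obtain m n w where "concat (replicate m w) = T [False]" "concat (replicate n w) = T [True]"
    using comm_append_are_replicate by blast
  then have "T [False] = word_power w m" "T [True] = word_power w n"
    by (simp_all add: word_power_def)
  with assms show False
    unfolding aperiodic_def by blast
qed

lemma omega_product_inf_image:
  assumes "aperiodic T"
  shows "omega_product (T [False]) (T [True]) (inf_image T u)"
proof (coinduction arbitrary: u)
  case omega_product
  have "inf_image T u = T [shd u] @- inf_image T (stl u)"
    using aperiodic_nonempty[OF assms] by (cases u) (simp add: inf_image_def)
  then show ?case
    by (cases "shd u") auto
qed

theorem theorem20:
  fixes T :: "word \<Rightarrow> word"
  assumes "morphism T" and "aperiodic T"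
  shows "order_preserving_inf T \<or> order_reversing_inf T"
proof -
  obtain z a b where sep: "separated_by z a b (T [False]) (T [True])"
    using separated_by_if_not_commute[OF aperiodic_imp_not_commute[OF assms(2)]] by blast
  have images: "\<exists>x s t. inf_image T u = x @- a ## s \<and> inf_image T v = x @- b ## t"
    if "lex_less u v" for u v
  proof -
    \<comment> \<open>The differing letters are written as one-letter words so that
      \<open>inf_image_shift\<close> also splits off their images.\<close>
    from that obtain x y y' where u: "u = x @- [False] @- y" and v: "v = x @- [True] @- y'"
      by (auto simp: lex_less_def)
    obtain s t where "T [False] @- inf_image T y = z @- a ## s"
      "T [True] @- inf_image T y' = z @- b ## t"
      using sep omega_product_inf_image[OF assms(2)] unfolding separated_by_def by metis
    then have "inf_image T u = (T x @ z) @- a ## s" "inf_image T v = (T x @ z) @- b ## t"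
      unfolding u v inf_image_shift[OF assms] by simp_all
    then show ?thesis by blast
  qed
  have "a < b \<or> b < a"
    using sep by (auto simp: separated_by_def)
  then show ?thesis
  proof
    assume "a < b"
    then have "lex_less (inf_image T u) (inf_image T v)" if "lex_less u v" for u v
      using images[OF that] unfolding lex_less_def by blast
    then have "order_preserving_inf T"
      unfolding order_preserving_inf_def lex_le_def by blast
    then show ?thesis ..
  next
    assume "b < a"
    then have "lex_less (inf_image T v) (inf_image T u)" if "lex_less u v" for u v
      using images[OF that] unfolding lex_less_def by blast
    then have "order_reversing_inf T"
      unfolding order_reversing_inf_def by blast
    then show ?thesis ..
  qed
qed

end
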